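(* Let $\mathcal{W}=\boldsymbol{w}_1\otimes\cdots\otimes\boldsymbol{w}_n\in\mathbb{R}^{d_1\times\cdots\times d_n}$ (outer product of vectors $\boldsymbol{w}_k\in\mathbb{R}^{d_k}$) have strictly positive entries, and fix $\Omega\subseteq[d_1]\times\cdots\times[d_n]$. Suppose that $\mathcal{T}\in\mathbb{R}^{d_1\times\cdots\times d_n}$ has Tucker rank $\boldsymbol{r}=[r_1,\ldots,r_n]$. Suppose that $\mathcal{Z}_{i_1\cdots i_n}\sim\mathcal{N}(0,\sigma^2)$, let $\mathcal{Y}_\Omega=\mathcal{T}_\Omega+\mathcal{Z}_\Omega$, and let $$\widehat{\mathcal{T}}=\mathcal{W}^{(-1/2)}\boxdot\underset{\text{Tucker rank}(\mathcal{X})=\boldsymbol{r}}{\operatorname{argmin}}\ \|\mathcal{X}-\mathcal{W}^{(-1/2)}\boxdot\mathcal{Y}_\Omega\|_F .$$ Then with probability at least $1-2^{-|\Omega|/2}$ over the choice of $\mathcal{Z}$, $$\|\mathcal{W}^{(1/2)}\boxdot(\mathcal{T}-\widehat{\mathcal{T}})\|_F\leq 4\sigma\mu\sqrt{|\Omega|\ln(2)}+2\|\mathcal{T}\|_{\infty}\,\|\mathcal{W}^{(1/2)}-\mathcal{W}^{(-1/2)}\boxdot \boldsymbol{1}_{\Omega}\|_F,$$ where $\mu^2=\max_{(i_1,\ldots,i_n)\in\Omega}\frac{1}{\mathcal{W}_{i_1\cdots i_n}}$.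
   Context: Notation. $[d]=\{1,\ldots,d\}$. Tensors are real arrays $\mathcal{X}\in\mathbb{R}^{d_1\times\cdots\times d_n}$ with entries $\mathcal{X}_{i_1\cdots i_n}$; $\mathcal{Z}$ is a random (noise) tensor in $\mathbb{R}^{d_1\times\cdots\times d_n}$. The outer product is $(\boldsymbol{w}_1\otimes\cdots\otimes\boldsymbol{w}_n)_{i_1\cdots i_n}=\prod_{k=1}^n\boldsymbol{w}_k(i_k)$. $\boxdot$ is the Hadamard (entrywise) product. For $\alpha\in\mathbb{R}$, $\mathcal{X}^{(\alpha)}$ is the entrywise power, $(\mathcal{X}^{(\alpha)})_{i_1\cdots i_n}=(\mathcal{X}_{i_1\cdots i_n})^\alpha$. $\boldsymbol{1}_\Omega$ is the tensor with entries $1$ on $\Omega$ and $0$ elsewhere, and $\mathcal{X}_\Omega=\boldsymbol{1}_\Omega\boxdot\mathcal{X}$. $\|\mathcal{X}\|_F=\big(\sum_{i_1,\ldots,i_n}\mathcal{X}_{i_1\cdots i_n}^2\big)^{1/2}$ and $\|\mathcal{X}\|_\infty=\max_{i_1,\ldots,i_n}|\mathcal{X}_{i_1\cdots i_n}|$. The mode-$k$ matricization $\mathcal{X}_{(k)}\in\mathbb{R}^{d_k\times\prod_{j\ne k}d_j}$ is the matrix whose columns are all the vectors obtained from $\mathcal{X}$ by fixing all indices except the $k$-th. The Tucker rank of $\mathcal{X}$ is the tuple $(r_1,\ldots,r_n)$ with $r_k=\operatorname{rank}(\mathcal{X}_{(k)})$. $\widehat{\mathcal{T}}$ is the optimal output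 of the displayed minimization problem, i.e. $\mathcal{W}^{(-1/2)}$ multiplied entrywise with a minimizer. *)

theory Defs
  imports
    "HOL-Probability.Probability"
    "HOL-Library.Function_Algebras"
    "Jordan_Normal_Form.DL_Rank"
begin

unbundle no vec_syntax

text \<open>
  A tensor of format \<open>d\<^sub>1 \<times> \<dots> \<times> d\<^sub>n\<close> is a real function on multi-indices, which are lists of
  length \<open>n\<close>. The format is a list of dimensions \<open>ds\<close>, and both modes and index entries are
  counted from 0. Only the values on \<open>tensor_idx ds\<close> are entries of the tensor; every notion
  below that takes \<open>ds\<close> ignores all other values. Sums and differences of tensors are the
  pointwise ones on functions.
\<close>

type_synonym tensor = "nat list \<Rightarrow> real"

definition tensor_idx :: "nat list \<Rightarrow> nat list set" where
  "tensor_idx ds = {is. length is = length ds \<and> (\<forall>k<length ds. is ! k < ds ! k)}"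

definition outer_product :: "real vec list \<Rightarrow> tensor" where
  "outer_product ws = (\<lambda>is. \<Prod>k<length ws. (ws ! k) $ (is ! k))"

definition hadamard :: "tensor \<Rightarrow> tensor \<Rightarrow> tensor" (infixl "\<boxdot>" 70) where
  "X \<boxdot> Y = (\<lambda>is. X is * Y is)"

text \<open>Entrywise power; \<open>powr\<close> is the real power only for positive entries.\<close>

definition tensor_powr :: "tensor \<Rightarrow> real \<Rightarrow> tensor" where
  "tensor_powr X \<alpha> = (\<lambda>is. X is powr \<alpha>)"

definition tensor_restrict :: "nat list set \<Rightarrow> tensor \<Rightarrow> tensor" where
  "tensor_restrict \<Omega> X = indicat_real \<Omega> \<boxdot> X"

definition frob_norm :: "nat list \<Rightarrow> tensor \<Rightarrow> real" where
  "frob_norm ds X = sqrt (\<Sum>is\<in>tensor_idx ds. (X is)\<^sup>2)"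

definition max_norm :: "nat list \<Rightarrow> tensor \<Rightarrow> real" where
  "max_norm ds X = (MAX is\<in>tensor_idx ds. \<bar>X is\<bar>)"

text \<open>
  The columns of the mode-\<open>k\<close> matricization are indexed by the multi-indices \<open>js\<close> of the other
  modes, listed in lexicographic order; the entry in row \<open>i\<close> and column \<open>js\<close> is found by
  inserting \<open>i\<close> into \<open>js\<close> at position \<open>k\<close>.
\<close>

definition matricization :: "nat list \<Rightarrow> nat \<Rightarrow> tensor \<Rightarrow> real mat" where
  "matricization ds k X =
     mat_of_cols (ds ! k)
       (map (\<lambda>js. vec (ds ! k) (\<lambda>i. X (take k js @ i # drop k js)))
         (product_lists (map (\<lambda>d. [0..<d]) (take k ds @ drop (Suc k) ds))))"

definition tucker_rank :: "nat list \<Rightarrow> tensor \<Rightarrow> nat list" where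
  "tucker_rank ds X = map (\<lambda>k. vec_space.rank (ds ! k) (matricization ds k X)) [0..<length ds]"

text \<open>
  The set of all optimal outputs: the minimizer need not be unique, and, since the tensors of a
  fixed Tucker rank do not form a closed set, it need not exist.
\<close>

definition weighted_estimates :: "nat list \<Rightarrow> tensor \<Rightarrow> nat list \<Rightarrow> tensor \<Rightarrow> tensor set" where
  "weighted_estimates ds W r Y =
     {tensor_powr W (-1/2) \<boxdot> X | X.
        is_arg_min (\<lambda>X. frob_norm ds (X - tensor_powr W (-1/2) \<boxdot> Y)) (\<lambda>X. tucker_rank ds X = r) X}"

text \<open>
  \<open>N(m, s\<^sup>2)\<close>; \<open>normal_density\<close> is not a density for \<open>s = 0\<close>, where the law is the point mass.
\<close>

definition normal_law :: "real \<Rightarrow> real \<Rightarrow> real measure" where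
  "normal_law m s = (if s = 0 then return borel m else density lborel (normal_density m s))"

text \<open>
  The constant \<open>\<mu>\<close>. For empty \<open>\<Omega>\<close> the value is unspecified.
\<close>

definition inv_weight_const :: "tensor \<Rightarrow> nat list set \<Rightarrow> real" where
  "inv_weight_const W \<Omega> = sqrt (MAX is\<in>\<Omega>. 1 / W is)"

end

theory Submission
  imports Defs
begin

text \<open>
  Scaling a tensor entrywise by the outer product of vectors without zero entries scales the rows
  and columns of every matricization by nonzero factors, so \<open>tensor_powr W (1/2) \<boxdot> T\<close> is itself a
  candidate in the minimization. Hence the minimizer is at most twice as far from it as the data
  are, and this distance splits into a sampling error, bounded by
  \<open>max_norm ds T\<close>, and the noise on \<open>\<Omega>\<close>, weighted by at most \<open>\<mu>\<close>. The squared noise is a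
  sum of independent squared Gaussians, which Chernoff's bound controls.
\<close>

section \<open>Invariance of the Tucker rank under scaling by outer products\<close>

text \<open>In matrix terms \<open>B = diag a * A * diag b\<close>. The right factor is invertible
  and only reparametrizes the coefficient vectors; the left factor, written \<open>f\<close>, maps
  the column space of \<open>A\<close> linearly and bijectively onto that of
  \<open>B\<close>.\<close>

lemma (in vec_space) rank_scale_rows_cols:
  fixes a b :: "nat \<Rightarrow> 'a"
  assumes A: "A \<in> carrier_mat n nc" and B: "B \<in> carrier_mat n nc"
    and BA: "\<And>i j. i < n \<Longrightarrow> j < nc \<Longrightarrow> B $$ (i, j) = a i * b j * A $$ (i, j)"
    and a: "\<And>i. i < n \<Longrightarrow> a i \<noteq> 0" and b: "\<And>j. j < nc \<Longrightarrow> b j \<noteq> 0"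
  shows "rank B = rank A"
proof -
  define f where "f v = vec n (\<lambda>i. a i * v $ i)" for v
  let ?VA = "span_vs (set (cols A))" and ?VB = "span_vs (set (cols B))"
  have colsA: "set (cols A) \<subseteq> carrier_vec n" and colsB: "set (cols B) \<subseteq> carrier_vec n"
    using A B cols_dim by blast+
  have spanA: "span (set (cols A)) = {A *\<^sub>v x | x. x \<in> carrier_vec nc}"
    using col_space_eq[OF A] A unfolding col_space_def by auto
  have spanB: "span (set (cols B)) = {B *\<^sub>v x | x. x \<in> carrier_vec nc}"
    using col_space_eq[OF B] B unfolding col_space_def by auto
  have f_mult: "f (A *\<^sub>v vec nc (\<lambda>j. b j * x $ j)) = B *\<^sub>v x" if "x \<in> carrier_vec nc" for x
    using A B that
    by (intro eq_vecI)
       (auto simp: f_def scalar_prod_def sum_distrib_left BA mult_ac intro!: sum.cong)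
  \<comment> \<open>Division by \<open>b\<close> inverts the column scaling, so every element
    \<open>A *\<^sub>v x\<close> of the column space has the form that \<open>f_mult\<close>
    handles.\<close>
  have scale: "vec nc (\<lambda>j. b j * vec nc (\<lambda>j. x $ j / b j) $ j) = x" if "x \<in> carrier_vec nc" for x
    using that b by (intro eq_vecI) auto
  have img: "f ` span (set (cols A)) = span (set (cols B))"
  proof (intro equalityI subsetI)
    fix y assume "y \<in> f ` span (set (cols A))"
    then obtain x where x: "x \<in> carrier_vec nc" "y = f (A *\<^sub>v x)"
      unfolding spanA by auto
    then have "y = B *\<^sub>v vec nc (\<lambda>j. x $ j / b j)"
      using f_mult[of "vec nc (\<lambda>j. x $ j / b j)"] scale[OF x(1)] by simp
    then show "y \<in> span (set (cols B))"
      unfolding spanB by auto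
  next
    fix y assume "y \<in> span (set (cols B))"
    then obtain x where x: "x \<in> carrier_vec nc" "y = B *\<^sub>v x"
      unfolding spanB by auto
    then have "y = f (A *\<^sub>v vec nc (\<lambda>j. b j * x $ j))"
      by (simp add: f_mult)
    then show "y \<in> f ` span (set (cols A))"
      unfolding spanA by (intro image_eqI[where f = f]) (auto intro!: exI[of _ "vec nc (\<lambda>j. b j * x $ j)"])
  qed
  have inj: "inj_on f (carrier_vec n)"
  proof (rule inj_onI, rule eq_vecI)
    fix u v i assume uv: "u \<in> carrier_vec n" "v \<in> carrier_vec n" "f u = f v" and "i < dim_vec v"
    then have "f u $ i = f v $ i" "i < n" by auto
    then show "u $ i = v $ i" using a[of i] by (simp add: f_def)
  qed auto
  have subA: "span (set (cols A)) \<subseteq> carrier_vec n"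
    by (rule span_is_subset2[OF colsA])
  have VA: "vectorspace class_ring ?VA" and VB: "vectorspace class_ring ?VB"
    using colsA colsB span_is_subspace subspace_is_vs by auto
  have lin: "linear_map class_ring ?VA ?VB f"
  proof -
    have "f \<in> LinearCombinations.module_hom class_ring ?VA ?VB"
      unfolding LinearCombinations.module_hom_def
      using img subA by (auto simp: f_def algebra_simps subset_iff intro!: eq_vecI)
    then show ?thesis
      using VA VB unfolding linear_map_def mod_hom_def mod_hom_axioms_def vectorspace_def by auto
  qed
  have "vectorspace.dim class_ring ?VA = vectorspace.dim class_ring ?VB"
    by (rule linear_map.dim_eq[OF lin fin_dim_span_cols[OF A]])
       (use inj subA img in \<open>auto intro: inj_on_subset\<close>)
  then show ?thesis unfolding rank_def by simp
qed

text \<open>Links the columns of \<open>matricization\<close> to \<open>tensor_idx\<close>, so that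
  hypotheses about the entries of a tensor apply to the entries of its matricizations.\<close>

lemma insert_index_in_tensor_idx:
  assumes js: "js \<in> set (product_lists (map (\<lambda>d. [0..<d]) (take k ds @ drop (Suc k) ds)))"
    and k: "k < length ds" and i: "i < ds ! k"
  shows "take k js @ i # drop k js \<in> tensor_idx ds"
proof -
  have len: "length js = length ds - 1"
    using in_set_product_lists_length[OF js] k by auto
  have js_nth: "js ! l < (take k ds @ drop (Suc k) ds) ! l" if "l < length js" for l
    using js that unfolding product_lists_set mem_Collect_eq list_all2_conv_all_nth
    by (metis (no_types, lifting) atLeastLessThan_iff length_map nth_map set_upt)
  show ?thesis
    unfolding tensor_idx_def
  proof (intro CollectI conjI allI impI)
    show "length (take k js @ i # drop k js) = length ds"
      using len k by auto
    fix l assume l: "l < length ds"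
    consider "l < k" | "l = k" | "k < l" by linarith
    then show "(take k js @ i # drop k js) ! l < ds ! l"
    proof cases
      case 1
      then show ?thesis using js_nth[of l] len k by (auto simp: nth_append)
    next
      case 2
      then show ?thesis using len k i by (auto simp: nth_append)
    next
      case 3
      \<comment> \<open>Behind the inserted entry positions shift by one: position
        \<open>Suc m\<close> of the full list is position \<open>m\<close> of \<open>js\<close>, and
        likewise for \<open>ds\<close> with its entry \<open>k\<close> removed.\<close>
      then obtain m where m: "l = Suc m" "k \<le> m" by (cases l) auto
      have "js ! m < (take k ds @ drop (Suc k) ds) ! m"
        using len l m by (intro js_nth) auto
      also have "(take k ds @ drop (Suc k) ds) ! m = ds ! l"
        using m k l by (simp add: nth_append)
      finally show ?thesis using m len k l by (simp add: nth_append nth_Cons')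
    qed
  qed
qed

text \<open>In the mode-\<open>k\<close> matricization the factor of mode \<open>k\<close> depends
  only on the row, and the product of the other factors only on the column. Multiplication by
  \<open>S\<close> therefore scales rows and columns by nonzero numbers.\<close>

lemma tucker_rank_hadamard_outer:
  assumes S: "\<And>is. is \<in> tensor_idx ds \<Longrightarrow> S is = (\<Prod>l<length ds. v l (is ! l))"
    and v: "\<And>l i. l < length ds \<Longrightarrow> i < ds ! l \<Longrightarrow> v l i \<noteq> (0::real)"
    and ds: "\<forall>d\<in>set ds. 0 < d"
  shows "tucker_rank ds (S \<boxdot> X) = tucker_rank ds X"
  unfolding tucker_rank_def
proof (intro map_cong refl)
  fix k assume "k \<in> set [0..<length ds]"
  then have k: "k < length ds" by auto
  define cs where "cs = product_lists (map (\<lambda>d. [0..<d]) (take k ds @ drop (Suc k) ds))"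
  define ins where "ins c i = take k (cs ! c) @ i # drop k (cs ! c)" for c i
  \<comment> \<open>Row 0 is a placeholder: the factor of mode \<open>k\<close> is left out, so
    every row yields the same column factor. The row exists because the dimensions are
    positive.\<close>
  define b where "b c = (\<Prod>l\<in>{..<length ds} - {k}. v l (ins c 0 ! l))" for c
  have idx: "ins c i \<in> tensor_idx ds" if "c < length cs" "i < ds ! k" for c i
    using insert_index_in_tensor_idx[OF _ k that(2), of "cs ! c"] that(1)
    unfolding ins_def cs_def by auto
  have dk: "0 < ds ! k" using ds k by auto
  have len: "length (cs ! c) = length ds - 1" if "c < length cs" for c
    using idx[OF that dk] unfolding tensor_idx_def ins_def by auto
  have S_ins: "S (ins c i) = v k i * b c" if "c < length cs" "i < ds ! k" for c i
  proof -
    have "S (ins c i) = v k (ins c i ! k) * (\<Prod>l\<in>{..<length ds} - {k}. v l (ins c i ! l))"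
      using k by (simp add: S idx that prod.remove)
    also have "(\<Prod>l\<in>{..<length ds} - {k}. v l (ins c i ! l)) = b c"
      unfolding b_def using len[OF that(1)] k
      by (intro prod.cong) (auto simp: ins_def nth_append nth_Cons')
    also have "ins c i ! k = i"
      using len[OF that(1)] k by (auto simp: ins_def nth_append)
    finally show ?thesis .
  qed
  have b: "b c \<noteq> 0" if "c < length cs" for c
    using idx[OF that dk] v unfolding b_def tensor_idx_def by auto
  have entry: "matricization ds k X $$ (i, c) = X (ins c i)"
    if "c < length cs" "i < ds ! k" for X :: tensor and c i
    using that by (simp add: matricization_def mat_of_cols_def ins_def cs_def)
  show "vec_space.rank (ds ! k) (matricization ds k (S \<boxdot> X)) =
        vec_space.rank (ds ! k) (matricization ds k X)"
    by (rule vec_space.rank_scale_rows_cols[where nc = "length cs" and a = "v k" and b = b])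
       (use k in \<open>auto simp: entry S_ins hadamard_def b v, auto simp: matricization_def cs_def\<close>)
qed

section \<open>Estimates for the Frobenius norm\<close>

lemma frob_norm_eq_L2_set: "frob_norm ds X = L2_set X (tensor_idx ds)"
  by (simp add: frob_norm_def L2_set_def)

lemma frob_norm_triangle: "frob_norm ds (X + Y) \<le> frob_norm ds X + frob_norm ds Y"
  by (simp add: frob_norm_eq_L2_set L2_set_triangle_ineq plus_fun_def)

lemma finite_tensor_idx: "finite (tensor_idx ds)"
proof (rule finite_subset)
  show "tensor_idx ds \<subseteq> {is. set is \<subseteq> {..<Suc (Max (set ds))} \<and> length is = length ds}"
    by (fastforce simp: tensor_idx_def in_set_conv_nth less_Suc_eq_le
         intro: order.trans[OF less_imp_le Max_ge])
qed (intro finite_lists_length_eq, simp)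

lemma frob_norm_mono:
  assumes "\<And>is. is \<in> tensor_idx ds \<Longrightarrow> \<bar>X is\<bar> \<le> \<bar>Y is\<bar>"
  shows "frob_norm ds X \<le> frob_norm ds Y"
  unfolding frob_norm_def by (intro real_sqrt_le_mono sum_mono) (simp add: assms flip: abs_le_square_iff)

lemma frob_norm_cong:
  assumes "\<And>is. is \<in> tensor_idx ds \<Longrightarrow> \<bar>X is\<bar> = \<bar>Y is\<bar>"
  shows "frob_norm ds X = frob_norm ds Y"
  by (intro antisym frob_norm_mono) (simp_all add: assms)

lemma frob_norm_scale: "0 \<le> c \<Longrightarrow> frob_norm ds (\<lambda>is. c * X is) = c * frob_norm ds X"
  by (simp add: frob_norm_eq_L2_set L2_set_right_distrib)

lemma abs_le_max_norm: "is \<in> tensor_idx ds \<Longrightarrow> \<bar>X is\<bar> \<le> max_norm ds X"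
  unfolding max_norm_def by (intro Max_ge) (auto simp: finite_tensor_idx)

lemma frob_norm_hadamard_le:
  assumes "\<forall>d\<in>set ds. 0 < d"
  shows "frob_norm ds (X \<boxdot> Y) \<le> max_norm ds Y * frob_norm ds X"
proof -
  \<comment> \<open>Positive dimensions make the index set nonempty, so \<open>max_norm\<close> is a
    genuine maximum and hence nonnegative.\<close>
  have "replicate (length ds) 0 \<in> tensor_idx ds"
    using assms by (auto simp: tensor_idx_def)
  then have 0: "0 \<le> max_norm ds Y"
    using abs_le_max_norm[of _ ds Y] by (meson abs_ge_zero order.trans)
  have "frob_norm ds (X \<boxdot> Y) \<le> frob_norm ds (\<lambda>is. max_norm ds Y * X is)"
    using 0 by (intro frob_norm_mono)
       (auto simp: hadamard_def abs_mult mult.commute[of "max_norm ds Y"] abs_le_max_norm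
         intro!: mult_left_mono)
  then show ?thesis
    by (simp add: frob_norm_scale 0)
qed

section \<open>Tail bound for sums of squared Gaussians\<close>

text \<open>The exponential factor halves the coefficient of \<open>x\<^sup>2\<close> in the
  Gaussian exponent, which leaves the shape of the centred normal density with variance
  \<open>2 * \<sigma>\<^sup>2\<close>; \<open>sqrt 2\<close> is the ratio of the two normalizing
  constants.\<close>

lemma nn_integral_exp_square_normal:
  assumes "0 < \<sigma>"
  shows "(\<integral>\<^sup>+x. exp (x\<^sup>2 / (4 * \<sigma>\<^sup>2)) \<partial>normal_law 0 \<sigma>) = sqrt 2"
proof -
  have *: "normal_density 0 \<sigma> x * exp (x\<^sup>2 / (4 * \<sigma>\<^sup>2)) = sqrt 2 * normal_density 0 (sqrt 2 * \<sigma>) x" for x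
    using assms
    by (simp add: normal_density_def real_sqrt_mult power_mult_distrib field_simps flip: exp_add)
  have "(\<integral>\<^sup>+x. exp (x\<^sup>2 / (4 * \<sigma>\<^sup>2)) \<partial>normal_law 0 \<sigma>)
      = (\<integral>\<^sup>+x. ennreal (normal_density 0 \<sigma> x) * ennreal (exp (x\<^sup>2 / (4 * \<sigma>\<^sup>2))) \<partial>lborel)"
    using assms by (simp add: normal_law_def nn_integral_density)
  also have "\<dots> = (\<integral>\<^sup>+x. ennreal (sqrt 2) * ennreal (normal_density 0 (sqrt 2 * \<sigma>) x) \<partial>lborel)"
    by (simp add: * flip: ennreal_mult')
  also have "\<dots> = ennreal (sqrt 2) * (\<integral>\<^sup>+x. ennreal (normal_density 0 (sqrt 2 * \<sigma>) x) \<partial>lborel)"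
    by (simp add: nn_integral_cmult)
  also have "(\<integral>\<^sup>+x. ennreal (normal_density 0 (sqrt 2 * \<sigma>) x) \<partial>lborel) = 1"
    using assms by (subst nn_integral_eq_integral) auto
  finally show ?thesis by simp
qed

text \<open>
  The Chernoff parameter \<open>1 / (4 * \<sigma>\<^sup>2)\<close> makes each factor of the moment generating function
  equal to \<open>sqrt 2\<close>, and \<open>2 powr (m / 2) * 2 powr (- m) = 2 powr (- m / 2)\<close>. For \<open>\<sigma> = 0\<close>
  the sum vanishes almost surely.
\<close>

lemma (in prob_space) normal_sum_squares_tail:
  assumes fin: "finite I" and ind: "indep_vars (\<lambda>_. borel) X I"
    and law: "\<And>i. i \<in> I \<Longrightarrow> distr M borel (X i) = normal_law 0 \<sigma>" and "0 \<le> \<sigma>"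
  shows "prob {\<omega>\<in>space M. (\<Sum>i\<in>I. (X i \<omega>)\<^sup>2) \<le> 4 * \<sigma>\<^sup>2 * (real (card I) * ln 2)}
           \<ge> 1 - 2 powr (- real (card I) / 2)"
    (is "prob ?E \<ge> _")
proof -
  have [measurable]: "X i \<in> borel_measurable M" if "i \<in> I" for i
    using ind that unfolding indep_vars_def by auto
  have sum_meas [measurable]: "(\<lambda>\<omega>. \<Sum>i\<in>I. (X i \<omega>)\<^sup>2) \<in> borel_measurable M"
    by measurable
  show ?thesis
  proof (cases "\<sigma> = 0")
    case True
    have "AE \<omega> in M. X i \<omega> = 0" if "i \<in> I" for i
    proof -
      have "AE x in distr M borel (X i). x = 0"
        unfolding law[OF that] using True by (subst normal_law_def) (simp add: AE_return)
      then show ?thesis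
        using that by (subst (asm) AE_distr_iff) auto
    qed
    then have "AE \<omega> in M. \<forall>i\<in>I. X i \<omega> = 0"
      using fin by (intro AE_finite_allI) auto
    then have "AE \<omega> in M. \<omega> \<in> ?E"
      using AE_space by eventually_elim (simp add: True)
    moreover have "?E \<in> events" by measurable
    ultimately have "prob ?E = 1"
      using prob_eq_1 by blast
    then show ?thesis by simp
  next
    case False
    with \<open>0 \<le> \<sigma>\<close> have \<sigma>: "0 < \<sigma>" by simp
    define m where "m = card I"
    let ?s = "1 / (4 * \<sigma>\<^sup>2)" and ?t = "4 * \<sigma>\<^sup>2 * (real m * ln 2)"
    let ?F = "{\<omega>\<in>space M. (\<Sum>i\<in>I. (X i \<omega>)\<^sup>2) \<ge> ?t}"
    have st: "?s * ?t = real m * ln 2" using \<sigma> by simp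
    \<comment> \<open>With values in \<open>ennreal\<close> the product rule for expectations can be
      applied without integrability of the exponentials.\<close>
    have ind': "indep_vars (\<lambda>_. borel) (\<lambda>i \<omega>. ennreal (exp (?s * (X i \<omega>)\<^sup>2))) I"
      by (rule indep_vars_compose2[OF ind]) measurable
    have mgf: "(\<integral>\<^sup>+\<omega>. ennreal (exp (?s * (X i \<omega>)\<^sup>2)) \<partial>M) = ennreal (sqrt 2)" if "i \<in> I" for i
    proof -
      have "(\<integral>\<^sup>+\<omega>. ennreal (exp (?s * (X i \<omega>)\<^sup>2)) \<partial>M)
          = (\<integral>\<^sup>+x. ennreal (exp (x\<^sup>2 / (4 * \<sigma>\<^sup>2))) \<partial>distr M borel (X i))"
        using that by (subst nn_integral_distr) auto
      then show ?thesis
        using nn_integral_exp_square_normal[OF \<sigma>] by (simp add: law that)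
    qed
    have "emeasure M ?F \<le> ennreal (exp (- ?s * ?t)) *
        (\<integral>\<^sup>+\<omega>. ennreal (exp (?s * (\<Sum>i\<in>I. (X i \<omega>)\<^sup>2))) * indicator (space M) \<omega> \<partial>M)"
      by (rule Chernoff_ineq_nn_integral_ge) (use \<sigma> in auto)
    also have "(\<integral>\<^sup>+\<omega>. ennreal (exp (?s * (\<Sum>i\<in>I. (X i \<omega>)\<^sup>2))) * indicator (space M) \<omega> \<partial>M)
        = (\<integral>\<^sup>+\<omega>. (\<Prod>i\<in>I. ennreal (exp (?s * (X i \<omega>)\<^sup>2))) \<partial>M)"
      by (intro nn_integral_cong) (simp add: sum_distrib_left exp_sum fin prod_ennreal)
    also have "\<dots> = (\<Prod>i\<in>I. \<integral>\<^sup>+\<omega>. ennreal (exp (?s * (X i \<omega>)\<^sup>2)) \<partial>M)"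
      by (rule indep_vars_nn_integral[OF fin ind']) auto
    also have "\<dots> = (\<Prod>i\<in>I. ennreal (sqrt 2))"
      by (intro prod.cong refl mgf)
    also have "\<dots> = ennreal (sqrt 2 ^ m)"
      by (simp add: m_def ennreal_power)
    also have "ennreal (exp (- ?s * ?t)) * \<dots> = ennreal (2 powr (- real m / 2))"
    proof -
      have "exp (- ?s * ?t) = 2 powr (- real m)"
        using st by (simp add: powr_def)
      moreover have "sqrt 2 ^ m = 2 powr (real m / 2)"
        by (simp add: powr_half_sqrt [symmetric] powr_powr flip: powr_realpow)
      ultimately show ?thesis
        by (simp flip: ennreal_mult' powr_add)
    qed
    finally have "prob ?F \<le> 2 powr (- real m / 2)"
      by (simp add: emeasure_eq_measure)
    moreover have "1 - prob ?F \<le> prob ?E"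
    proof -
      have "1 - prob ?F = prob (space M - ?F)"
        by (subst prob_compl) auto
      \<comment> \<open>The complement of \<open>?F\<close> is the event of strict inequality, which
        lies inside \<open>?E\<close>.\<close>
      also have "\<dots> \<le> prob ?E"
        by (rule finite_measure_mono) (auto simp: m_def)
      finally show ?thesis .
    qed
    ultimately show ?thesis unfolding m_def by simp
  qed
qed

section \<open>Error bound for a fixed realization of the noise\<close>

lemma frob_norm_uminus: "frob_norm ds (- X) = frob_norm ds X"
  by (intro frob_norm_cong) simp

text \<open>Since \<open>S\<close> is feasible, \<open>X\<close> is no farther from \<open>A\<close>
  than \<open>S\<close> is; the triangle inequality through \<open>A\<close> gives the factor
  2.\<close>

lemma arg_min_error_le:
  assumes min: "is_arg_min (\<lambda>X. frob_norm ds (X - A)) P X" and "P S"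
  shows "frob_norm ds (S - X) \<le> 2 * frob_norm ds (S - A)"
proof -
  have "frob_norm ds (X - A) \<le> frob_norm ds (S - A)"
    using assms unfolding is_arg_min_linorder by blast
  moreover have "frob_norm ds (S - X) \<le> frob_norm ds (S - A) + frob_norm ds (- (X - A))"
    using frob_norm_triangle[of ds "S - A" "- (X - A)"] by simp
  ultimately show ?thesis by (simp only: frob_norm_uminus)
qed

text \<open>Only entries in \<Omega> contribute, and there the squared weight
  \<open>1 / W is\<close> is at most the maximum under the root in
  \<open>inv_weight_const\<close>.\<close>

lemma frob_norm_weighted_restrict_le:
  assumes \<Omega>: "\<Omega> \<subseteq> tensor_idx ds" and W: "\<And>is. is \<in> \<Omega> \<Longrightarrow> 0 < W is"
  shows "frob_norm ds (tensor_powr W (-1/2) \<boxdot> tensor_restrict \<Omega> Z)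
           \<le> inv_weight_const W \<Omega> * sqrt (\<Sum>is\<in>\<Omega>. (Z is)\<^sup>2)"
proof -
  let ?m = "MAX is\<in>\<Omega>. 1 / W is"
  have fin: "finite \<Omega>" using \<Omega> finite_tensor_idx finite_subset by blast
  have "(\<Sum>is\<in>tensor_idx ds. ((tensor_powr W (-1/2) \<boxdot> tensor_restrict \<Omega> Z) is)\<^sup>2)
      = (\<Sum>is\<in>\<Omega>. ((tensor_powr W (-1/2) \<boxdot> tensor_restrict \<Omega> Z) is)\<^sup>2)"
    by (rule sum.mono_neutral_right)
       (use \<Omega> finite_tensor_idx in \<open>auto simp: hadamard_def tensor_restrict_def\<close>)
  also have "\<dots> = (\<Sum>is\<in>\<Omega>. (1 / W is) * (Z is)\<^sup>2)"
  proof (rule sum.cong[OF refl])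
    fix "is" assume "is \<in> \<Omega>"
    moreover from this have "(W is powr (-1/2))\<^sup>2 = 1 / W is"
      using W[of "is"] by (simp add: powr_minus_divide powr_half_sqrt power_divide)
    ultimately show "((tensor_powr W (-1/2) \<boxdot> tensor_restrict \<Omega> Z) is)\<^sup>2 = (1 / W is) * (Z is)\<^sup>2"
      by (simp add: hadamard_def tensor_restrict_def tensor_powr_def power_mult_distrib)
  qed
  \<comment> \<open>For empty \<Omega> the value \<open>?m\<close> is unspecified, but both sums are
    empty.\<close>
  also have "\<dots> \<le> (\<Sum>is\<in>\<Omega>. ?m * (Z is)\<^sup>2)"
    using fin by (intro sum_mono mult_right_mono Max_ge) auto
  finally have "frob_norm ds (tensor_powr W (-1/2) \<boxdot> tensor_restrict \<Omega> Z)
      \<le> sqrt (?m * (\<Sum>is\<in>\<Omega>. (Z is)\<^sup>2))"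
    unfolding frob_norm_def by (simp add: sum_distrib_left)
  then show ?thesis
    by (simp add: inv_weight_const_def real_sqrt_mult)
qed

text \<open>No sign condition appears because \<open>sqrt\<close> is extended to negative reals as
  an odd function and is therefore multiplicative everywhere.\<close>

lemma sqrt_prod: "sqrt (prod f I) = (\<Prod>i\<in>I. sqrt (f i))"
  by (induction I rule: infinite_finite_induct) (simp_all add: real_sqrt_mult)

text \<open>Positivity of the outer product still allows negative entries in the vectors
  \<open>ws\<close>, as long as the signs cancel. The factors \<open>sqrt ((ws ! l) $ i)\<close> may
  thus be negative, but they are nonzero and multiply to the root of the product.\<close>

lemma tucker_rank_powr_half_outer:
  assumes ds: "\<forall>d\<in>set ds. 0 < d" and ws: "length ws = length ds"
    and W: "\<And>is. is \<in> tensor_idx ds \<Longrightarrow> 0 < outer_product ws is"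
  shows "tucker_rank ds (tensor_powr (outer_product ws) (1/2) \<boxdot> X) = tucker_rank ds X"
proof (rule tucker_rank_hadamard_outer[where v = "\<lambda>l i. sqrt ((ws ! l) $ i)"])
  fix "is" assume "is \<in> tensor_idx ds"
  from W[OF this] show "tensor_powr (outer_product ws) (1/2) is = (\<Prod>l<length ds. sqrt ((ws ! l) $ (is ! l)))"
    by (simp add: tensor_powr_def powr_half_sqrt outer_product_def sqrt_prod ws)
next
  fix l i assume li: "l < length ds" "i < ds ! l"
  \<comment> \<open>This multi-index exhibits entry \<open>i\<close> of vector \<open>l\<close> as
    one factor of a positive product, so that entry cannot vanish.\<close>
  let ?is = "(replicate (length ds) 0)[l := i]"
  have "?is \<in> tensor_idx ds"
    using ds li by (auto simp: tensor_idx_def nth_list_update)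
  from W[OF this] have "0 < (\<Prod>k<length ds. (ws ! k) $ (?is ! k))"
    by (simp add: outer_product_def ws)
  then have "(ws ! l) $ (?is ! l) \<noteq> 0"
    using li prod_zero[of "{..<length ds}" "\<lambda>k. (ws ! k) $ (?is ! k)"] by fastforce
  then show "sqrt ((ws ! l) $ i) \<noteq> 0"
    using li by simp
qed (rule ds)

text \<open>No probability enters: the noise is a fixed tensor, and its energy on \<Omega> remains
  in the bound, to be controlled later.\<close>

lemma weighted_estimate_error_le:
  assumes ds: "\<forall>d\<in>set ds. 0 < d" and ws: "length ws = length ds" and W_def: "W = outer_product ws"
    and W: "\<And>is. is \<in> tensor_idx ds \<Longrightarrow> 0 < W is" and \<Omega>: "\<Omega> \<subseteq> tensor_idx ds"
    and T_hat: "T_hat \<in> weighted_estimates ds W (tucker_rank ds T)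
                          (tensor_restrict \<Omega> T + tensor_restrict \<Omega> Z)"
  shows "frob_norm ds (tensor_powr W (1/2) \<boxdot> (T - T_hat))
           \<le> 2 * (inv_weight_const W \<Omega> * sqrt (\<Sum>is\<in>\<Omega>. (Z is)\<^sup>2))
             + 2 * max_norm ds T *
               frob_norm ds (tensor_powr W (1/2) - tensor_powr W (-1/2) \<boxdot> indicat_real \<Omega>)"
proof -
  define U V where "U = tensor_powr W (1/2)" and "V = tensor_powr W (-1/2)"
  define Y where "Y = tensor_restrict \<Omega> T + tensor_restrict \<Omega> Z"
  define D where "D = U - V \<boxdot> indicat_real \<Omega>"
  obtain X where X: "T_hat = V \<boxdot> X"
    and min: "is_arg_min (\<lambda>X. frob_norm ds (X - V \<boxdot> Y)) (\<lambda>X. tucker_rank ds X = tucker_rank ds T) X"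
    using T_hat unfolding weighted_estimates_def V_def Y_def by blast
  have rank: "tucker_rank ds (U \<boxdot> T) = tucker_rank ds T"
    using tucker_rank_powr_half_outer[OF ds ws] W unfolding U_def W_def by simp
  \<comment> \<open>The weights \<open>U\<close> and \<open>V\<close> are entrywise inverse, so
    weighting the estimate by \<open>U\<close> recovers the minimizer \<open>X\<close>
    itself.\<close>
  have "frob_norm ds (U \<boxdot> (T - T_hat)) = frob_norm ds (U \<boxdot> T - X)"
  proof (rule frob_norm_cong)
    fix "is" assume "is \<in> tensor_idx ds"
    from W[OF this] have "U is * V is = 1"
      by (simp add: U_def V_def tensor_powr_def flip: powr_add)
    then show "\<bar>(U \<boxdot> (T - T_hat)) is\<bar> = \<bar>(U \<boxdot> T - X) is\<bar>"
      by (simp add: X hadamard_def right_diff_distrib flip: mult.assoc)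
  qed
  also have "\<dots> \<le> 2 * frob_norm ds (U \<boxdot> T - V \<boxdot> Y)"
    by (rule arg_min_error_le[OF min rank])
  finally have approx: "frob_norm ds (U \<boxdot> (T - T_hat)) \<le> 2 * frob_norm ds (U \<boxdot> T - V \<boxdot> Y)" .
  \<comment> \<open>Restriction to \<Omega> is multiplication by its indicator, so \<open>D\<close>
    collects all terms containing \<open>T\<close>: it measures how far the weighted sampling
    pattern is from \<open>U\<close>.\<close>
  have "U \<boxdot> T - V \<boxdot> Y = D \<boxdot> T + - (V \<boxdot> tensor_restrict \<Omega> Z)"
    by (simp add: fun_eq_iff hadamard_def D_def Y_def tensor_restrict_def algebra_simps)
  then have "frob_norm ds (U \<boxdot> T - V \<boxdot> Y)
      \<le> frob_norm ds (D \<boxdot> T) + frob_norm ds (V \<boxdot> tensor_restrict \<Omega> Z)"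
    using frob_norm_triangle[of ds "D \<boxdot> T" "- (V \<boxdot> tensor_restrict \<Omega> Z)"]
    by (simp only: frob_norm_uminus)
  also have "\<dots> \<le> max_norm ds T * frob_norm ds D + inv_weight_const W \<Omega> * sqrt (\<Sum>is\<in>\<Omega>. (Z is)\<^sup>2)"
    unfolding V_def using \<Omega> W
    by (intro add_mono frob_norm_hadamard_le[OF ds] frob_norm_weighted_restrict_le) auto
  finally show ?thesis
    using approx unfolding D_def U_def V_def by linarith
qed

section \<open>The error bound with high probability\<close>

theorem theorem1:
  fixes ds r :: "nat list"
    and ws :: "real vec list"
    and W T :: tensor
    and \<Omega> :: "nat list set"
    and M :: "'a measure"
    and Z :: "'a \<Rightarrow> tensor"
    and \<sigma> \<mu> :: real
  assumes "ds \<noteq> []" and "\<forall>d\<in>set ds. 0 < d"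
    and "map dim_vec ws = ds" and "W = outer_product ws"
    and "\<forall>is\<in>tensor_idx ds. 0 < W is"
    and "\<Omega> \<subseteq> tensor_idx ds"
    and "tucker_rank ds T = r"
    and "prob_space M" and "0 \<le> \<sigma>"
    and "prob_space.indep_vars M (\<lambda>_. borel) (\<lambda>is \<omega>. Z \<omega> is) (tensor_idx ds)"
    and "\<forall>is\<in>tensor_idx ds. distr M borel (\<lambda>\<omega>. Z \<omega> is) = normal_law 0 \<sigma>"
    and "\<mu> = inv_weight_const W \<Omega>"
  shows "\<exists>E\<in>sets M. measure M E \<ge> 1 - 2 powr (- real (card \<Omega>) / 2) \<and>
    (\<forall>\<omega>\<in>E. \<forall>T_hat\<in>weighted_estimates ds W r (tensor_restrict \<Omega> T + tensor_restrict \<Omega> (Z \<omega>)).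
       frob_norm ds (tensor_powr W (1/2) \<boxdot> (T - T_hat))
         \<le> 4 * \<sigma> * \<mu> * sqrt (real (card \<Omega>) * ln 2)
           + 2 * max_norm ds T *
             frob_norm ds (tensor_powr W (1/2) - tensor_powr W (-1/2) \<boxdot> indicat_real \<Omega>))"
proof -
  interpret prob_space M by fact
  \<comment> \<open>The event constrains only the noise energy on \<Omega>. It is therefore
    measurable and serves all minimizers at once, whether or not they depend measurably on the
    noise.\<close>
  define E where "E = {\<omega>\<in>space M. (\<Sum>is\<in>\<Omega>. (Z \<omega> is)\<^sup>2) \<le> 4 * \<sigma>\<^sup>2 * (real (card \<Omega>) * ln 2)}"
  have fin: "finite \<Omega>"
    using \<open>\<Omega> \<subseteq> tensor_idx ds\<close> finite_tensor_idx finite_subset by blast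
  have ind: "indep_vars (\<lambda>_. borel) (\<lambda>is \<omega>. Z \<omega> is) \<Omega>"
    by (rule indep_vars_subset) fact+
  then have [measurable]: "(\<lambda>\<omega>. Z \<omega> is) \<in> borel_measurable M" if "is \<in> \<Omega>" for "is"
    using that unfolding indep_vars_def by auto
  have "E \<in> events"
    unfolding E_def by measurable
  moreover have "prob E \<ge> 1 - 2 powr (- real (card \<Omega>) / 2)"
    unfolding E_def using assms(6,11) by (intro normal_sum_squares_tail[OF fin ind _ assms(9)]) auto
  moreover have "frob_norm ds (tensor_powr W (1/2) \<boxdot> (T - T_hat))
         \<le> 4 * \<sigma> * \<mu> * sqrt (real (card \<Omega>) * ln 2)
           + 2 * max_norm ds T *
             frob_norm ds (tensor_powr W (1/2) - tensor_powr W (-1/2) \<boxdot> indicat_real \<Omega>)"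
    if "\<omega> \<in> E"
      and T_hat: "T_hat \<in> weighted_estimates ds W r (tensor_restrict \<Omega> T + tensor_restrict \<Omega> (Z \<omega>))"
    for \<omega> T_hat
  proof -
    have "sqrt (\<Sum>is\<in>\<Omega>. (Z \<omega> is)\<^sup>2) \<le> sqrt (4 * \<sigma>\<^sup>2 * (real (card \<Omega>) * ln 2))"
      using \<open>\<omega> \<in> E\<close> unfolding E_def by (intro real_sqrt_le_mono) simp
    also have "\<dots> = 2 * \<sigma> * sqrt (real (card \<Omega>) * ln 2)"
      using \<open>0 \<le> \<sigma>\<close> by (simp add: real_sqrt_mult)
    finally have noise: "sqrt (\<Sum>is\<in>\<Omega>. (Z \<omega> is)\<^sup>2) \<le> 2 * \<sigma> * sqrt (real (card \<Omega>) * ln 2)" .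
    have "\<mu> * sqrt (\<Sum>is\<in>\<Omega>. (Z \<omega> is)\<^sup>2) \<le> \<mu> * (2 * \<sigma> * sqrt (real (card \<Omega>) * ln 2))"
    \<comment> \<open>Multiplying by \<mu> needs its sign. For empty \<Omega> it is unspecified, but
      then both sides vanish.\<close>
    proof (cases "\<Omega> = {}")
      case False
      then obtain "is" where mem: "is \<in> \<Omega>" by blast
      then have "0 \<le> 1 / W is" using assms(5,6) by (auto intro: less_imp_le)
      also have "\<dots> \<le> (MAX is\<in>\<Omega>. 1 / W is)" using fin mem by (intro Max_ge) auto
      finally have "0 \<le> \<mu>" unfolding assms(12) inv_weight_const_def by simp
      then show ?thesis using noise by (rule mult_left_mono[rotated])
    qed simp
    moreover have "length ws = length ds"
      using assms(3) by auto
    then have "frob_norm ds (tensor_powr W (1/2) \<boxdot> (T - T_hat))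
           \<le> 2 * (\<mu> * sqrt (\<Sum>is\<in>\<Omega>. (Z \<omega> is)\<^sup>2))
             + 2 * max_norm ds T *
               frob_norm ds (tensor_powr W (1/2) - tensor_powr W (-1/2) \<boxdot> indicat_real \<Omega>)"
      unfolding assms(12) using assms(5) T_hat[folded assms(7)]
      by (intro weighted_estimate_error_le[OF assms(2) _ assms(4) _ assms(6)]) auto
    \<comment> \<open>The constant 4 is the factor 2 from the minimization times the factor 2 from
      the root of the threshold \<open>4 * \<sigma>\<^sup>2\<close>.\<close>
    moreover have "4 * \<sigma> * \<mu> * sqrt (real (card \<Omega>) * ln 2)
        = 2 * (\<mu> * (2 * \<sigma> * sqrt (real (card \<Omega>) * ln 2)))"
      by simp
    ultimately show ?thesis by linarith
  qed
  ultimately show ?thesis by blast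
qed

end
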